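(* There exists a polygon $P$ in the plane $\mathbb{R}^2$ that is the union of $5$ squares with side length $1$ and for which the perimeter-to-area ratio satisfies $$\frac{p(P)}{a(P)} > 4 .$$
   Context: Squares are closed solid (filled) squares in $\mathbb{R}^2$, in arbitrary position (arbitrary centre and rotation). A polygon is a closed region bounded by a simple closed polygonal chain. For a polygon $P$, $p(P)$ denotes its perimeter (length of its boundary) and $a(P)$ its area. *)

theory Defs
  imports "HOL-Analysis.Analysis"
begin

text \<open>The angle \<open>\<theta>\<close> is the rotation of the square about its centre \<open>c\<close>; \<open>l\<close> is the side length.\<close>

definition solid_square :: "real \<Rightarrow> real^2 \<Rightarrow> real \<Rightarrow> (real^2) set" where
  "solid_square l c \<theta> =
     {c + x *\<^sub>R vector [cos \<theta>, sin \<theta>] + y *\<^sub>R vector [- sin \<theta>, cos \<theta>] | x y.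
        \<bar>x\<bar> \<le> l / 2 \<and> \<bar>y\<bar> \<le> l / 2}"

definition is_square :: "real \<Rightarrow> (real^2) set \<Rightarrow> bool" where
  "is_square l Q \<longleftrightarrow> (\<exists>c \<theta>. Q = solid_square l c \<theta>)"

fun chain_path :: "(real^2) list \<Rightarrow> real \<Rightarrow> real^2" where
  "chain_path [] = linepath 0 0"
| "chain_path [a] = linepath a a"
| "chain_path [a, b] = linepath a b"
| "chain_path (a # b # c # vs) = linepath a b +++ chain_path (b # c # vs)"

text \<open>A closed chain is given by its list of vertices, with the first vertex not repeated at
  the end. Since \<^const>\<open>simple_path\<close> allows only the two endpoints of a path to coincide, it
  also excludes repeated vertices and edges of length zero. Consecutive edges may be collinear.\<close>

definition closed_chain :: "(real^2) list \<Rightarrow> real \<Rightarrow> real^2" where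
  "closed_chain vs = chain_path (vs @ [hd vs])"

definition simple_closed_chain :: "(real^2) list \<Rightarrow> bool" where
  "simple_closed_chain vs \<longleftrightarrow> 3 \<le> length vs \<and> simple_path (closed_chain vs)"

definition polygon_bounded_by :: "(real^2) list \<Rightarrow> (real^2) set \<Rightarrow> bool" where
  "polygon_bounded_by vs P \<longleftrightarrow>
     simple_closed_chain vs \<and>
     P = path_image (closed_chain vs) \<union> inside (path_image (closed_chain vs))"

text \<open>If \<open>polygon_bounded_by vs P\<close>, this is the perimeter of \<open>P\<close>: the boundary of \<open>P\<close> is the
  union of the edges, which overlap only in endpoints.\<close>

definition chain_length :: "(real^2) list \<Rightarrow> real" where
  "chain_length vs = (\<Sum>i<length vs. dist (vs ! i) (vs ! (Suc i mod length vs)))"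

end

theory Submission
  imports Defs
begin

text \<open>
  A family of concentric unit squares has a union with ratio exactly 4, because every edge lies at
  distance 1/2 from the common centre. Moving the squares slightly off centre can increase the
  ratio; a numerical search gave the configuration below, with ratio about 4.0477.

  All five squares contain the origin in their interiors, so the union is star-shaped and its
  boundary is a chain ordered by polar angle. The union is contained in the union of the triangles
  spanned by the origin and the edges, which bounds its area from above.
\<close>

section \<open>Closed chains\<close>

definition steps :: "'a list \<Rightarrow> ('a \<times> 'a) list" where
  "steps xs = zip xs (tl xs)"

definition edges :: "'a list \<Rightarrow> ('a \<times> 'a) list" where
  "edges vs = steps (vs @ [hd vs])"

lemma steps_simps [simp]:
  "steps [] = []" "steps [x] = []" "steps (x # y # xs) = (x, y) # steps (y # xs)"
  by (simp_all add: steps_def)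

lemma successively_iff_steps: "successively P xs \<longleftrightarrow> (\<forall>(x, y)\<in>set (steps xs). P x y)"
  by (induction P xs rule: successively.induct) auto

lemma steps_append: "steps (xs @ y # ys) = steps (xs @ [y]) @ steps (y # ys)"
proof (induction xs)
  case (Cons x xs)
  then show ?case by (cases xs) auto
qed simp

lemma edges_append:
  assumes "us \<noteq> []" "ls \<noteq> []"
  shows "edges (us @ ls) = steps (us @ [hd ls]) @ steps (ls @ [hd us])"
  using assms steps_append[of us "hd ls" "tl ls @ [hd us]"] by (simp add: edges_def flip: append_Cons)

lemma length_edges [simp]: "vs \<noteq> [] \<Longrightarrow> length (edges vs) = length vs"
  by (simp add: edges_def steps_def)

lemma nth_edges:
  assumes "i < length vs"
  shows "edges vs ! i = (vs ! i, vs ! (Suc i mod length vs))"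
proof -
  have "vs \<noteq> []" using assms by auto
  then have eq: "edges vs = zip (vs @ [hd vs]) (tl vs @ [hd vs])"
    by (simp add: edges_def steps_def)
  have "(tl vs @ [hd vs]) ! i = vs ! (Suc i mod length vs)"
  proof (cases "Suc i = length vs")
    case True
    then show ?thesis using \<open>vs \<noteq> []\<close> by (simp add: nth_append hd_conv_nth flip: True)
  next
    case False
    then have "i < length (tl vs)" using assms by simp
    then show ?thesis using assms False by (simp add: nth_append nth_tl)
  qed
  then show ?thesis
    using assms by (simp add: eq nth_append)
qed

text \<open>Indices modulo \<open>length vs\<close> give way to a list sum, which can be compared
  entry by entry with a list of explicit lengths.\<close>

lemma chain_length_edges:
  assumes "vs \<noteq> []"
  shows "chain_length vs = (\<Sum>(p, q)\<leftarrow>edges vs. dist p q)"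
proof -
  have "(\<Sum>(p, q)\<leftarrow>edges vs. dist p q) = (\<Sum>i<length vs. case edges vs ! i of (p, q) \<Rightarrow> dist p q)"
    using assms by (simp add: sum_list_sum_nth lessThan_atLeast0)
  also have "\<dots> = chain_length vs"
    unfolding chain_length_def by (intro sum.cong) (simp_all add: nth_edges)
  finally show ?thesis by simp
qed

section \<open>Endpoints and images of chain paths\<close>

lemma pathstart_chain: "ws \<noteq> [] \<Longrightarrow> pathstart (chain_path ws) = hd ws"
  by (induction ws rule: chain_path.induct) auto

lemma pathfinish_chain: "ws \<noteq> [] \<Longrightarrow> pathfinish (chain_path ws) = last ws"
  by (induction ws rule: chain_path.induct) auto

text \<open>Stated from two vertices on: a single vertex gives the constant path with image
  \<open>{a}\<close>, whereas \<open>steps [a]\<close> is empty.\<close>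

lemma path_image_chain:
  "path_image (chain_path (a # b # ws)) = (\<Union>(p, q)\<in>set (steps (a # b # ws)). closed_segment p q)"
proof (induction ws arbitrary: a b)
  case (Cons c ws)
  then show ?case by (simp add: path_image_join pathstart_chain)
qed simp

lemma path_image_closed_chain:
  assumes "vs \<noteq> []"
  shows "path_image (closed_chain vs) = (\<Union>(p, q)\<in>set (edges vs). closed_segment p q)"
proof (cases vs)
  case (Cons a ws)
  then show ?thesis
    by (cases ws) (simp_all add: closed_chain_def edges_def path_image_chain)
qed (use assms in simp)

section \<open>Angular order\<close>

text \<open>Twice the signed area of the triangle \<open>0, p, q\<close>; positive iff
  \<open>q\<close> lies counterclockwise from \<open>p\<close> by an angle strictly between 0 and
  pi.\<close>

definition wedge :: "real^2 \<Rightarrow> real^2 \<Rightarrow> real" where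
  "wedge p q = p $ 1 * q $ 2 - p $ 2 * q $ 1"

text \<open>The polar angles in [0, pi). Taking only the positive half of the axis makes negation
  exchange this set with the remaining nonzero points.\<close>

definition upper :: "real^2 \<Rightarrow> bool" where
  "upper p \<longleftrightarrow> p $ 2 > 0 \<or> p $ 2 = 0 \<and> p $ 1 > 0"

text \<open>The strict order of polar angles in \<open>[0, 2\<pi>)\<close>.\<close>

definition prec :: "real^2 \<Rightarrow> real^2 \<Rightarrow> bool" where
  "prec p q \<longleftrightarrow> (if upper p \<longleftrightarrow> upper q then wedge p q > 0 else upper p)"

lemma prec_irrefl: "\<not> prec p p"
  by (simp add: prec_def wedge_def)

lemma wedge_self [simp]: "wedge p p = 0"
  by (simp add: wedge_def)

text \<open>This is the three-term Pluecker relation with (1, 0) as fourth vector. Second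
  coordinates are nonnegative here, and those of \<open>q\<close> and \<open>r\<close> are positive
  because neither can lie on the initial ray.\<close>

lemma wedge_trans_upper:
  assumes "upper p" "upper q" "upper r" "wedge p q > 0" "wedge q r > 0"
  shows "wedge p r > 0"
proof -
  have id: "q $ 2 * wedge p r = r $ 2 * wedge p q + p $ 2 * wedge q r"
    by (simp add: wedge_def algebra_simps)
  have "r $ 2 > 0"
    using assms(2,3,5) by (auto simp: upper_def wedge_def)
      (smt (verit) mult_nonneg_nonneg)
  moreover have "q $ 2 > 0"
    using assms(1,2,4) by (auto simp: upper_def wedge_def)
      (smt (verit) mult_nonneg_nonneg)
  moreover have "p $ 2 \<ge> 0"
    using assms(1) by (auto simp: upper_def)
  ultimately have "q $ 2 * wedge p r > 0"
    unfolding id using assms(4,5) by (intro add_pos_nonneg) auto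
  with \<open>q $ 2 > 0\<close> show ?thesis
    by (simp add: zero_less_mult_iff)
qed

lemma wedge_uminus [simp]: "wedge (- p) (- q) = wedge p q"
  by (simp add: wedge_def)

lemma upper_uminus: "\<not> upper p \<Longrightarrow> p \<noteq> 0 \<Longrightarrow> upper (- p)"
  by (auto simp: upper_def vec_eq_iff forall_2)

lemma wedge_0 [simp]: "wedge 0 p = 0" "wedge p 0 = 0"
  by (simp_all add: wedge_def)

text \<open>If \<open>p\<close> and \<open>r\<close> lie in the same half, so does \<open>q\<close>;
  the lower half reduces to the upper one by negation, which preserves \<open>wedge\<close>.\<close>

lemma prec_trans:
  assumes "prec p q" "prec q r"
  shows "prec p r"
proof (cases "upper p \<longleftrightarrow> upper r")
  case True
  then have u: "upper p \<longleftrightarrow> upper q" "upper q \<longleftrightarrow> upper r"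
    using assms by (auto simp: prec_def split: if_splits)
  then have w: "wedge p q > 0" "wedge q r > 0"
    using assms by (auto simp: prec_def)
  then have "p \<noteq> 0" "q \<noteq> 0" "r \<noteq> 0" by auto
  then have "wedge p r > 0"
    using wedge_trans_upper[of p q r] wedge_trans_upper[of "-p" "-q" "-r"] upper_uminus u w
    by (cases "upper p") auto
  with True show ?thesis by (simp add: prec_def)
qed (use assms in \<open>auto simp: prec_def split: if_splits\<close>)

lemma prec_asym: "prec p q \<Longrightarrow> \<not> prec q p"
  using prec_trans[of p q p] prec_irrefl by auto

text \<open>At parameter \<open>u\<close>, \<open>wedge p x\<close> and \<open>wedge x q\<close> are
  the fractions \<open>u\<close> and \<open>1 - u\<close> of \<open>wedge p q\<close>, so the angle
  increases along the segment. It remains to see in which half \<open>x\<close> lies.\<close>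

lemma prec_segment:
  assumes "prec p q" "wedge p q > 0" "x \<in> closed_segment p q"
  shows "x = p \<or> prec p x" "x = q \<or> prec x q"
proof -
  obtain u where u: "0 \<le> u" "u \<le> 1" and x: "x = (1 - u) *\<^sub>R p + u *\<^sub>R q"
    using assms(3) by (auto simp: in_segment)
  have w: "wedge p x = u * wedge p q" "wedge x q = (1 - u) * wedge p q"
    by (simp_all add: wedge_def x algebra_simps)
  have 0: "u = 0 \<or> wedge p x > 0" "u = 1 \<or> wedge x q > 0"
    using u assms(2) by (auto simp: w zero_less_mult_iff)
  have xp: "u = 0 \<Longrightarrow> x = p" "u = 1 \<Longrightarrow> x = q"
    by (simp_all add: x)
  have x2: "x $ 2 = (1 - u) * p $ 2 + u * q $ 2" and x1: "x $ 1 = (1 - u) * p $ 1 + u * q $ 1"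
    by (simp_all add: x)
  \<comment> \<open>Leaving the half is possible only on the horizontal axis; an interior point
    there would make \<open>p\<close> and \<open>q\<close> both horizontal, hence
    \<open>wedge p q = 0\<close>.\<close>
  have up: "upper x" if "upper p" "upper q"
  proof (cases "x $ 2 > 0")
    case False
    have nn: "p $ 2 \<ge> 0" "q $ 2 \<ge> 0" using that by (auto simp: upper_def)
    then have "(1 - u) * p $ 2 = 0" "u * q $ 2 = 0"
      using False u x2 by (smt (verit) mult_nonneg_nonneg)+
    then have "wedge p q = 0 \<or> u = 0 \<or> u = 1"
      by (auto simp: wedge_def)
    then show ?thesis using that assms(2) x by auto
  qed (simp add: upper_def)
  have lo: "\<not> upper x" if "\<not> upper p" "\<not> upper q"
  proof -
    have nn: "p $ 2 \<le> 0" "q $ 2 \<le> 0" using that by (auto simp: upper_def)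
    then have *: "(1 - u) * p $ 2 \<le> 0" "u * q $ 2 \<le> 0"
      using u by (simp_all add: mult_nonneg_nonpos)
    show ?thesis
    proof
      assume "upper x"
      then have "x $ 2 = 0" using * x2 by (auto simp: upper_def)
      then have "(1 - u) * p $ 2 = 0" "u * q $ 2 = 0"
        using * x2 by linarith+
      then have "wedge p q = 0 \<or> u = 0 \<or> u = 1"
        by (auto simp: wedge_def)
      then show False using that assms(2) x \<open>upper x\<close> by auto
    qed
  qed
  show "x = p \<or> prec p x" "x = q \<or> prec x q"
    using 0 xp up lo assms(1) unfolding prec_def by metis+
qed

text \<open>The closing edge ends on the positive axis, where the angle jumps from 2 pi back to 0,
  so \<open>prec_segment\<close> does not apply. All its points except \<open>q\<close> still have
  negative second coordinate and are compared by \<open>wedge\<close>.\<close>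

lemma prec_closing_segment:
  assumes "wedge p q > 0" "p $ 2 < 0" "q $ 2 = 0" "x \<in> closed_segment p q"
  shows "x = p \<or> x = q \<or> prec p x"
proof -
  obtain u where u: "0 \<le> u" "u \<le> 1" and x: "x = (1 - u) *\<^sub>R p + u *\<^sub>R q"
    using assms(4) by (auto simp: in_segment)
  have w: "wedge p x = u * wedge p q"
    by (simp add: wedge_def x algebra_simps)
  have "x $ 2 < 0" if "u \<noteq> 1"
    using that u assms by (simp add: x mult_pos_neg)
  then show ?thesis
    using u assms by (cases "u = 0"; cases "u = 1") (auto simp: prec_def upper_def x w[unfolded x])
qed

text \<open>Induction from the front; the second conjunct is the invariant that keeps a newly added
  first edge away from the rest of the chain.\<close>

lemma arc_chain:
  assumes "successively (\<lambda>p q. prec p q \<and> wedge p q > 0) (b # vs)"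
    and "wedge (last (b # vs)) z > 0" "last (b # vs) $ 2 < 0" "z $ 2 = 0" "prec z b"
  shows "arc (chain_path (b # vs @ [z])) \<and>
    (\<forall>x\<in>path_image (chain_path (b # vs @ [z])). x = b \<or> x = z \<or> prec b x)"
  using assms
proof (induction vs arbitrary: b)
  case Nil
  then have "wedge b z > 0" "b $ 2 < 0" "b \<noteq> z" by auto
  then show ?case using prec_closing_segment[of b z] Nil.prems(4) by simp
next
  case (Cons c vs)
  have bc: "prec b c" "wedge b c > 0" using Cons.prems by auto
  have zc: "prec z c" using Cons.prems(5) bc(1) by (rule prec_trans)
  have IH: "arc (chain_path (c # vs @ [z]))"
    "\<And>x. x \<in> path_image (chain_path (c # vs @ [z])) \<Longrightarrow> x = c \<or> x = z \<or> prec c x"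
    using Cons.IH[of c] Cons.prems zc by auto
  have eq: "chain_path (b # (c # vs) @ [z]) = linepath b c +++ chain_path (c # vs @ [z])"
    by (cases vs) auto
  have start: "pathstart (chain_path (c # vs @ [z])) = c"
    by (simp add: pathstart_chain)
  have "b \<noteq> c" using bc by auto
  have int: "path_image (linepath b c) \<inter> path_image (chain_path (c # vs @ [z])) \<subseteq> {c}"
  proof
    fix x assume "x \<in> path_image (linepath b c) \<inter> path_image (chain_path (c # vs @ [z]))"
    then have x: "x \<in> closed_segment b c" "x \<in> path_image (chain_path (c # vs @ [z]))"
      by auto
    have s: "x = b \<or> prec b x" "x = c \<or> prec x c"
      using prec_segment[OF bc x(1)] by auto
    \<comment> \<open>On the new edge \<open>x\<close> is at or before \<open>c\<close>, on the rest
      at or after it. The exception \<open>x = z\<close> fails because \<open>z\<close> precedes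
      \<open>b\<close>.\<close>
    have "x = c"
      using IH(2)[OF x(2)] s Cons.prems(5) prec_asym[of x c] prec_asym[of z b] prec_irrefl[of z]
      by auto
    then show "x \<in> {c}" by simp
  qed
  have arc: "arc (chain_path (b # (c # vs) @ [z]))"
    unfolding eq using \<open>b \<noteq> c\<close> IH(1) int by (intro arc_join) (simp_all add: start)
  have "x = b \<or> x = z \<or> prec b x" if "x \<in> path_image (chain_path (b # (c # vs) @ [z]))" for x
  proof -
    have "x \<in> closed_segment b c \<or> x \<in> path_image (chain_path (c # vs @ [z]))"
      using that unfolding eq by (simp add: path_image_join start)
    then show ?thesis
      using prec_segment(1)[OF bc, of x] IH(2)[of x] bc(1) prec_trans[OF bc(1), of x] by auto
  qed
  then have "\<forall>x\<in>path_image (chain_path (b # (c # vs) @ [z])). x = b \<or> x = z \<or> prec b x"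
    by (rule ballI)
  with arc show ?case by (rule conjI)
qed

text \<open>The edges after the first form an arc from \<open>b\<close> back to \<open>a\<close>.
  Apart from its end \<open>a\<close> it stays at or after \<open>b\<close> in angle, and the first
  edge stays at or before \<open>b\<close>, so they meet only in \<open>a\<close> and
  \<open>b\<close>.\<close>

lemma simple_path_closed_chain:
  assumes E: "successively (\<lambda>p q. prec p q \<and> wedge p q > 0) (a # b # vs)"
    and "wedge (last (b # vs)) a > 0" "last (b # vs) $ 2 < 0" "a $ 2 = 0"
  shows "simple_path (closed_chain (a # b # vs))"
proof -
  have ab: "prec a b" "wedge a b > 0" using E by auto
  have A: "arc (chain_path (b # vs @ [a]))"
    "\<And>x. x \<in> path_image (chain_path (b # vs @ [a])) \<Longrightarrow> x = b \<or> x = a \<or> prec b x"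
    using arc_chain[of b vs a] assms ab by auto
  have eq: "closed_chain (a # b # vs) = linepath a b +++ chain_path (b # vs @ [a])"
    unfolding closed_chain_def by (cases vs) auto
  have "a \<noteq> b" using ab by auto
  have int: "path_image (linepath a b) \<inter> path_image (chain_path (b # vs @ [a])) \<subseteq> {a, b}"
  proof
    fix x assume "x \<in> path_image (linepath a b) \<inter> path_image (chain_path (b # vs @ [a]))"
    then have x: "x \<in> closed_segment a b" "x \<in> path_image (chain_path (b # vs @ [a]))"
      by auto
    have "x = a \<or> x = b"
      using A(2)[OF x(2)] prec_segment(2)[OF ab x(1)] prec_asym[of x b] by auto
    then show "x \<in> {a, b}" by simp
  qed
  have ends: "pathstart (chain_path (b # vs @ [a])) = b" "pathfinish (chain_path (b # vs @ [a])) = a"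
    by (simp_all add: pathstart_chain pathfinish_chain)
  show ?thesis
    unfolding eq
    by (rule simple_path_join_loop) (use A(1) \<open>a \<noteq> b\<close> int ends in simp_all)
qed

text \<open>The vertices in \<open>us\<close> and \<open>ls\<close> have polar angles in \<open>[0, \<pi>)\<close> and \<open>[\<pi>, 2\<pi>)\<close>.\<close>

definition angular_chain :: "(real^2) list \<Rightarrow> (real^2) list \<Rightarrow> bool" where
  "angular_chain us ls \<longleftrightarrow> us \<noteq> [] \<and> ls \<noteq> [] \<and> tl us \<noteq> [] \<and> tl ls \<noteq> [] \<and>
     hd us $ 2 = 0 \<and> hd us $ 1 > 0 \<and> hd ls $ 2 = 0 \<and> hd ls $ 1 < 0 \<and>
     (\<forall>v\<in>set (tl us). v $ 2 > 0) \<and> (\<forall>v\<in>set (tl ls). v $ 2 < 0) \<and>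
     (\<forall>(p, q)\<in>set (edges (us @ ls)). wedge p q > 0)"

text \<open>Within each half \<open>prec\<close> is just positivity of \<open>wedge\<close>, and the
  step from \<open>us\<close> to \<open>ls\<close> passes from the upper to the lower half.\<close>

lemma simple_closed_chain_angular:
  assumes "angular_chain us ls"
  shows "simple_closed_chain (us @ ls)"
proof -
  obtain a b us' where us: "us = a # b # us'"
    using assms unfolding angular_chain_def by (metis list.exhaust_sel)
  obtain c d ls' where ls: "ls = c # d # ls'"
    using assms unfolding angular_chain_def by (metis list.exhaust_sel)
  have ne: "us \<noteq> []" "ls \<noteq> []" and a: "hd us = a" by (simp_all add: us ls)
  have edge: "\<forall>(p, q)\<in>set (edges (us @ ls)). wedge p q > 0"
    using assms unfolding angular_chain_def by (elim conjE)
  have "hd (us @ ls) = a" using ne a by simp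
  then have "successively (\<lambda>p q. wedge p q > 0) ((us @ ls) @ [a])"
    using edge by (simp only: edges_def successively_iff_steps)
  then have w: "successively (\<lambda>p q. wedge p q > 0) us" "successively (\<lambda>p q. wedge p q > 0) ls"
    "wedge (last us) (hd ls) > 0" "wedge (last ls) a > 0"
    using ne by (simp_all add: successively_append_iff)
  have up: "\<forall>v\<in>set us. upper v" and lo: "\<forall>v\<in>set ls. \<not> upper v"
    using assms by (auto simp: angular_chain_def us ls upper_def)
  have "successively (\<lambda>p q. prec p q \<and> wedge p q > 0) us"
    using w(1) up by (elim successively_mono) (auto simp: prec_def)
  moreover have "successively (\<lambda>p q. prec p q \<and> wedge p q > 0) ls"
    using w(2) lo by (elim successively_mono) (auto simp: prec_def)
  moreover have "prec (last us) (hd ls)"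
    using up lo by (simp add: prec_def us ls)
  ultimately have "successively (\<lambda>p q. prec p q \<and> wedge p q > 0) (us @ ls)"
    using w(3) by (simp add: successively_append_iff)
  moreover have "last ls $ 2 < 0" "a $ 2 = 0"
    using assms by (auto simp: angular_chain_def us ls)
  ultimately have "simple_path (closed_chain (us @ ls))"
    using simple_path_closed_chain[of a b "us' @ ls"] w(4) ne
    by (simp add: us)
  moreover have "3 \<le> length (us @ ls)" by (simp add: us ls)
  ultimately show ?thesis by (simp add: simple_closed_chain_def)
qed

section \<open>Cones over the edges cover the plane\<close>

lemma sign_change_step:
  assumes "xs \<noteq> []" "f (hd xs) \<ge> 0" "f (last (xs @ [z])) \<le> (0::real)"
  shows "\<exists>(p, q)\<in>set (steps (xs @ [z])). f p \<ge> 0 \<and> f q \<le> 0"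
  using assms
proof (induction xs)
  case (Cons x xs)
  show ?case
  proof (cases xs)
    case (Cons y ys)
    then show ?thesis using Cons.IH Cons.prems by (cases "f y \<ge> 0") auto
  qed (use Cons.prems in auto)
qed simp

text \<open>As \<open>p\<close> runs through the half of the chain on the side of \<open>x\<close>,
  \<open>wedge p x\<close> starts nonnegative and ends nonpositive, because both ends lie on the
  horizontal axis. The edge where the sign changes spans a cone containing \<open>x\<close>.\<close>

lemma angular_chain_cover:
  assumes "angular_chain us ls"
  obtains p q s t where "(p, q) \<in> set (edges (us @ ls))" "s \<ge> 0" "t \<ge> 0" "x = s *\<^sub>R p + t *\<^sub>R q"
proof -
  note D = assms[unfolded angular_chain_def]
  have "\<exists>(p, q)\<in>set (edges (us @ ls)). wedge p x \<ge> 0 \<and> wedge q x \<le> 0"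
  proof (cases "x $ 2 \<ge> 0")
    case True
    then show ?thesis
      using sign_change_step[of us "\<lambda>p. wedge p x" "hd ls"] D
      by (auto simp: edges_append wedge_def mult_le_0_iff)
  next
    case False
    then show ?thesis
      using sign_change_step[of ls "\<lambda>p. wedge p x" "hd us"] D
      by (auto simp: edges_append wedge_def mult_le_0_iff zero_le_mult_iff)
  qed
  then obtain p q where pq: "(p, q) \<in> set (edges (us @ ls))" "wedge p x \<ge> 0" "wedge q x \<le> 0"
    by blast
  then have w: "wedge p q > 0" using D by auto
  show thesis
  proof (rule that[OF pq(1)])
    show "- wedge q x / wedge p q \<ge> 0" "wedge p x / wedge p q \<ge> 0"
      using pq w by (simp_all add: divide_nonpos_pos)
    have "x = (1 / wedge p q) *\<^sub>R (wedge p q *\<^sub>R x)"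
      using w by simp
    \<comment> \<open>Cramer's rule for the coordinates of \<open>x\<close> in the basis
      \<open>p, q\<close>.\<close>
    also have "wedge p q *\<^sub>R x = (- wedge q x) *\<^sub>R p + wedge p x *\<^sub>R q"
      by (simp add: vec_eq_iff forall_2 wedge_def algebra_simps)
    finally show "x = (- wedge q x / wedge p q) *\<^sub>R p + (wedge p x / wedge p q) *\<^sub>R q"
      by (simp only: scaleR_add_right scaleR_scaleR times_divide_eq_left mult_1)
  qed
qed

section \<open>Star-shaped unions of convex regions\<close>

text \<open>A component of the complement of \<open>K - U\<close> that meets \<open>U\<close> cannot
  leave \<open>K\<close>, hence is bounded. A point outside \<open>K\<close> escapes to infinity
  along its outward ray, which avoids \<open>K\<close> by star-shapedness.\<close>

lemma inside_star_shaped: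
  fixes K U :: "'a::euclidean_space set"
  assumes "closed K" "bounded K" "open U" "U \<subseteq> K" "0 \<in> U"
    and starU: "\<And>x s. x \<in> U \<Longrightarrow> 0 \<le> s \<Longrightarrow> s \<le> 1 \<Longrightarrow> s *\<^sub>R x \<in> U"
    and starK: "\<And>x s. x \<in> K \<Longrightarrow> 0 \<le> s \<Longrightarrow> s \<le> 1 \<Longrightarrow> s *\<^sub>R x \<in> K"
  shows "inside (K - U) = U"
proof (rule set_eqI)
  fix x
  let ?C = "connected_component_set (- (K - U)) x"
  show "x \<in> inside (K - U) \<longleftrightarrow> x \<in> U"
  proof (cases "x \<in> U")
    case True
    have sub: "?C \<subseteq> U \<union> (- K)"
      using connected_component_subset by fastforce
    have "x \<in> U \<inter> ?C"
      using True by (simp add: connected_component_refl)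
    \<comment> \<open>\<open>U\<close> and \<open>- K\<close> are disjoint open sets covering the
      connected set \<open>?C\<close>.\<close>
    then have "(- K) \<inter> ?C = {}"
      using connectedD[OF connected_connected_component \<open>open U\<close>, of "- K" "- (K - U)" x] sub
        \<open>closed K\<close> \<open>U \<subseteq> K\<close> by blast
    then have "?C \<subseteq> K" by blast
    then show ?thesis
      using True \<open>bounded K\<close> by (auto simp: inside_def intro: bounded_subset)
  next
    case False
    have "\<not> bounded ?C" if "x \<notin> K"
    proof -
      let ?T = "(\<lambda>s. s *\<^sub>R x) ` {1..}"
      have "s *\<^sub>R x \<notin> K" if "s \<ge> 1" for s
      proof
        assume "s *\<^sub>R x \<in> K"
        then have "x \<in> K"
          using starK[of "s *\<^sub>R x" "1 / s"] that by simp
        then show False using \<open>x \<notin> K\<close> by simp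
      qed
      then have "?T \<subseteq> - (K - U)" by auto
      moreover have "connected ?T"
        by (intro connected_continuous_image continuous_intros) simp
      moreover have "x \<in> ?T" by (rule image_eqI[of _ _ 1]) auto
      ultimately have sub: "?T \<subseteq> ?C"
        by (intro connected_component_maximal)
      have "x \<noteq> 0" using assms that by auto
      have "\<not> bounded ?T"
      proof
        assume "bounded ?T"
        then obtain b where b: "\<And>s. s \<ge> 1 \<Longrightarrow> norm (s *\<^sub>R x) \<le> b"
          unfolding bounded_iff by auto
        define s where "s = max 1 ((b + 1) / norm x)"
        have "b + 1 \<le> s * norm x"
          using \<open>x \<noteq> 0\<close> by (simp add: s_def flip: pos_divide_le_eq)
        moreover have "s \<ge> 1" by (simp add: s_def)
        ultimately show False using b[of s] by simp
      qed
      then show ?thesis using sub bounded_subset by blast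
    qed
    then show ?thesis using False by (auto simp: inside_def)
  qed
qed

section \<open>Regions cut out by half-planes\<close>

type_synonym half_planes = "((real^2) \<times> real) list"

definition region :: "half_planes \<Rightarrow> (real^2) set" where
  "region H = {x. \<forall>(n, h)\<in>set H. n \<bullet> x \<le> h}"

definition open_region :: "half_planes \<Rightarrow> (real^2) set" where
  "open_region H = {x. \<forall>(n, h)\<in>set H. n \<bullet> x < h}"

lemma region_eq_INT: "region H = (\<Inter>(n, h)\<in>set H. {x. n \<bullet> x \<le> h})"
  by (auto simp: region_def)

lemma open_region_eq_INT: "open_region H = (\<Inter>(n, h)\<in>set H. {x. n \<bullet> x < h})"
  by (auto simp: open_region_def)

lemma closed_region: "closed (region H)"
  unfolding region_eq_INT by (intro closed_INT) (auto simp: closed_halfspace_le)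

lemma convex_region: "convex (region H)"
  unfolding region_eq_INT by (intro convex_INT) (auto simp: convex_halfspace_le)

lemma open_open_region: "open (open_region H)"
  unfolding open_region_eq_INT by (intro open_INT) (auto simp: open_halfspace_lt)

lemma open_region_subset: "open_region H \<subseteq> region H"
  by (force simp: region_def open_region_def)

lemma convex_open_region: "convex (open_region H)"
  unfolding open_region_eq_INT by (intro convex_INT) (auto simp: convex_halfspace_lt)

lemma convex_scaleR_mem:
  assumes "convex S" "0 \<in> S" "x \<in> S" "0 \<le> s" "s \<le> 1"
  shows "s *\<^sub>R x \<in> S"
  using convexD_alt[OF assms(1-5)] by simp

text \<open>The half-plane in the second conjunct keeps \<open>H\<close> from extending beyond the segment from
  \<open>p\<close> to \<open>q\<close> inside the cone that the origin spans with it.\<close>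

definition fits :: "half_planes list \<Rightarrow> real^2 \<Rightarrow> real^2 \<Rightarrow> bool" where
  "fits Hs p q \<longleftrightarrow> (\<exists>H\<in>set Hs. p \<in> region H \<and> q \<in> region H) \<and>
     (\<forall>H\<in>set Hs. \<exists>(n, h)\<in>set H. h \<le> n \<bullet> p \<and> h \<le> n \<bullet> q)"

text \<open>Repeated entries only add nonnegative terms, so distinctness of the edges need not be
  proved.\<close>

lemma sum_set_le_sum_list:
  fixes f :: "'a \<Rightarrow> real"
  assumes "\<And>x. x \<in> set xs \<Longrightarrow> 0 \<le> f x"
  shows "sum f (set xs) \<le> (\<Sum>x\<leftarrow>xs. f x)"
  using assms by (induction xs) (auto simp: sum.insert_if intro: add_increasing)

text \<open>Positive offsets put the origin inside every open region. For explicit data,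
  \<open>chain\<close> and \<open>fit\<close> are finitely many inequalities between
  numbers.\<close>

locale star_union =
  fixes Hs :: "half_planes list" and us ls :: "(real^2) list"
  assumes pos: "\<And>H n h. H \<in> set Hs \<Longrightarrow> (n, h) \<in> set H \<Longrightarrow> h > 0"
    and bdd: "\<And>H. H \<in> set Hs \<Longrightarrow> bounded (region H)"
    and chain: "angular_chain us ls"
    and fit: "\<And>p q. (p, q) \<in> set (edges (us @ ls)) \<Longrightarrow> fits Hs p q"
begin

definition K :: "(real^2) set" where "K = (\<Union>H\<in>set Hs. region H)"
definition U :: "(real^2) set" where "U = (\<Union>H\<in>set Hs. open_region H)"

lemma zero_in_open_region: "H \<in> set Hs \<Longrightarrow> 0 \<in> open_region H"
  using pos by (auto simp: open_region_def)

lemma zero_in_region: "H \<in> set Hs \<Longrightarrow> 0 \<in> region H"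
  using zero_in_open_region open_region_subset by (rule subsetD[rotated])

lemma nonempty: "us @ ls \<noteq> []"
  using chain by (auto simp: angular_chain_def)

text \<open>The half-plane that \<open>fits\<close> provides for the region containing the point
  gives \<open>(s + t) * h \<le> h\<close> with \<open>h > 0\<close>.\<close>

lemma cone_sum_le_1:
  assumes "(p, q) \<in> set (edges (us @ ls))" "0 \<le> s" "0 \<le> t" "s *\<^sub>R p + t *\<^sub>R q \<in> K"
  shows "s + t \<le> 1"
proof -
  obtain H where H: "H \<in> set Hs" "s *\<^sub>R p + t *\<^sub>R q \<in> region H"
    using assms by (auto simp: K_def)
  have "\<exists>(n, h)\<in>set H. h \<le> n \<bullet> p \<and> h \<le> n \<bullet> q"
    using fit[OF assms(1)] H(1) by (simp add: fits_def)
  then obtain n h where nh: "(n, h) \<in> set H" "h \<le> n \<bullet> p" "h \<le> n \<bullet> q"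
    by auto
  have "(s + t) * h \<le> s * (n \<bullet> p) + t * (n \<bullet> q)"
    using nh assms by (simp add: distrib_right add_mono mult_left_mono)
  also have "\<dots> \<le> h"
    using H nh by (auto simp: region_def inner_add_right)
  finally show ?thesis using pos[OF H(1) nh(1)] by simp
qed

text \<open>The region of \<open>fits\<close> that contains both \<open>p\<close> and
  \<open>q\<close> works: each of its inequalities becomes strict after scaling by
  \<open>s + t < 1\<close>.\<close>

lemma cone_in_U:
  assumes "(p, q) \<in> set (edges (us @ ls))" "0 \<le> s" "0 \<le> t" "s + t < 1"
  shows "s *\<^sub>R p + t *\<^sub>R q \<in> U"
proof -
  obtain H where H: "H \<in> set Hs" "p \<in> region H" "q \<in> region H"
    using fit[OF assms(1)] by (auto simp: fits_def)
  have "n \<bullet> (s *\<^sub>R p + t *\<^sub>R q) < h" if nh: "(n, h) \<in> set H" for n h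
  proof -
    have "s * (n \<bullet> p) + t * (n \<bullet> q) \<le> s * h + t * h"
      using H nh assms by (intro add_mono mult_left_mono) (auto simp: region_def)
    also have "\<dots> < h"
      using assms(4) pos[OF H(1) nh] by (simp flip: distrib_right)
    finally show ?thesis by (simp add: inner_add_right)
  qed
  then show ?thesis using H(1) by (auto simp: U_def open_region_def)
qed

lemma segment_subset:
  assumes "(p, q) \<in> set (edges (us @ ls))"
  shows "closed_segment p q \<subseteq> K - U"
proof
  fix x assume x: "x \<in> closed_segment p q"
  obtain H where H: "H \<in> set Hs" "p \<in> region H" "q \<in> region H"
    using fit[OF assms] by (auto simp: fits_def)
  then have "x \<in> K"
    using x closed_segment_subset[OF H(2,3) convex_region] by (auto simp: K_def)
  moreover have "x \<notin> open_region H" if "H \<in> set Hs" for H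
  proof -
    have "\<exists>(n, h)\<in>set H. h \<le> n \<bullet> p \<and> h \<le> n \<bullet> q"
      using fit[OF assms] that by (simp add: fits_def)
    then obtain n h where nh: "(n, h) \<in> set H" "h \<le> n \<bullet> p" "h \<le> n \<bullet> q"
      by auto
    have "closed_segment p q \<subseteq> {x. n \<bullet> x \<ge> h}"
      using nh by (intro closed_segment_subset convex_halfspace_ge) auto
    then have "h \<le> n \<bullet> x" using x by auto
    then show ?thesis using nh(1) by (auto simp: open_region_def intro!: bexI[of _ "(n, h)"])
  qed
  ultimately show "x \<in> K - U" by (auto simp: U_def)
qed

text \<open>In the cone coordinates of an edge, \<open>K\<close> forces \<open>s + t \<le> 1\<close>
  and \<open>s + t < 1\<close> forces \<open>U\<close>; what remains is \<open>s + t = 1\<close>,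
  the edge itself.\<close>

lemma path_image_eq: "path_image (closed_chain (us @ ls)) = K - U"
proof
  show "path_image (closed_chain (us @ ls)) \<subseteq> K - U"
    using segment_subset by (auto simp: path_image_closed_chain[OF nonempty])
  show "K - U \<subseteq> path_image (closed_chain (us @ ls))"
  proof
    fix x assume x: "x \<in> K - U"
    obtain p q s t where *: "(p, q) \<in> set (edges (us @ ls))" "s \<ge> 0" "t \<ge> 0"
      "x = s *\<^sub>R p + t *\<^sub>R q"
      using angular_chain_cover[OF chain] by metis
    have "s + t \<le> 1" using cone_sum_le_1 x * by auto
    moreover have "\<not> s + t < 1" using cone_in_U x * by auto
    ultimately have "s = 1 - t" by simp
    then have "x \<in> closed_segment p q"
      using *(2-4) unfolding in_segment by (intro exI[of _ t]) simp
    then show "x \<in> path_image (closed_chain (us @ ls))"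
      using *(1) unfolding path_image_closed_chain[OF nonempty] by blast
  qed
qed

lemma compact_K: "compact K"
  unfolding K_def using bdd closed_region
  by (intro compact_UN) (auto simp: compact_eq_bounded_closed)

lemma edge_exists: obtains p q where "(p, q) \<in> set (edges (us @ ls))"
  using nonempty length_edges[OF nonempty] by (cases "edges (us @ ls)") auto

theorem polygon: "polygon_bounded_by (us @ ls) K"
proof -
  have "0 \<in> U"
  proof -
    obtain p q where "(p, q) \<in> set (edges (us @ ls))" by (rule edge_exists)
    then show ?thesis using cone_in_U[of p q 0 0] by simp
  qed
  moreover have "U \<subseteq> K"
    using open_region_subset by (force simp: U_def K_def)
  moreover have "open U"
    unfolding U_def using open_open_region by blast
  moreover have "s *\<^sub>R x \<in> U" if "x \<in> U" "0 \<le> s" "s \<le> 1" for x s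
    using that convex_scaleR_mem[OF convex_open_region zero_in_open_region] by (auto simp: U_def)
  moreover have "s *\<^sub>R x \<in> K" if "x \<in> K" "0 \<le> s" "s \<le> 1" for x s
    using that convex_scaleR_mem[OF convex_region zero_in_region] by (auto simp: K_def)
  ultimately have "inside (K - U) = U"
    using compact_K by (intro inside_star_shaped) (auto simp: compact_eq_bounded_closed)
  then show ?thesis
    using \<open>U \<subseteq> K\<close> simple_closed_chain_angular[OF chain]
    by (auto simp: polygon_bounded_by_def path_image_eq)
qed

section \<open>Area bounds\<close>

lemma measure_triangle_0: "measure lebesgue (convex hull {0, p, q}) = \<bar>wedge p q\<bar> / 2"
proof -
  have "convex hull {0, p, q} \<in> sets borel"
    by (intro borel_compact finite_imp_compact_convex_hull) simp
  then have "measure lebesgue (convex hull {0, p, q}) = measure lborel (convex hull {0, p, q})"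
    by (simp add: measure_completion)
  also have "\<dots> = \<bar>wedge p q\<bar> / 2"
    by (simp add: content_triangle wedge_def abs_minus_commute mult.commute)
  finally show ?thesis .
qed

lemma triangle_lmeasurable: "convex hull {0, p, q :: real^2} \<in> lmeasurable"
  by (intro lmeasurable_compact finite_imp_compact_convex_hull) simp

text \<open>The triangles over the edges cover \<open>K\<close>, and subadditivity yields the
  shoelace sum as an upper bound, the direction that the ratio requires.\<close>

lemma measure_le: "measure lebesgue K \<le> (\<Sum>(p, q)\<leftarrow>edges (us @ ls). wedge p q / 2)"
proof -
  let ?E = "edges (us @ ls)"
  let ?T = "\<lambda>e. convex hull {0, fst e, snd e}"
  have sub: "K \<subseteq> (\<Union>e\<in>set ?E. ?T e)"
  proof
    fix x assume x: "x \<in> K"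
    obtain p q s t where *: "(p, q) \<in> set ?E" "s \<ge> 0" "t \<ge> 0" "x = s *\<^sub>R p + t *\<^sub>R q"
      using angular_chain_cover[OF chain] by metis
    have "s + t \<le> 1" using cone_sum_le_1 x * by auto
    then have "0 \<le> 1 - s - t" "(1 - s - t) + s + t = 1" "x = (1 - s - t) *\<^sub>R 0 + s *\<^sub>R p + t *\<^sub>R q"
      using * by simp_all
    then have "x \<in> convex hull {0, p, q}"
      using * unfolding convex_hull_3 by blast
    then show "x \<in> (\<Union>e\<in>set ?E. ?T e)" using *(1) by force
  qed
  have "measure lebesgue K \<le> measure lebesgue (\<Union>e\<in>set ?E. ?T e)"
    using sub compact_K triangle_lmeasurable
    by (intro measure_mono_fmeasurable fmeasurable.finite_UN)
      (auto intro: fmeasurableD lmeasurable_compact)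
  also have "\<dots> \<le> (\<Sum>e\<in>set ?E. measure lebesgue (?T e))"
    using triangle_lmeasurable by (intro measure_UNION_le) (auto intro: fmeasurableD)
  also have "\<dots> = (\<Sum>e\<in>set ?E. wedge (fst e) (snd e) / 2)"
    using chain by (intro sum.cong) (auto simp: measure_triangle_0 angular_chain_def)
  also have "\<dots> \<le> (\<Sum>e\<leftarrow>?E. wedge (fst e) (snd e) / 2)"
    using chain by (intro sum_set_le_sum_list) (auto simp: angular_chain_def)
  also have "\<dots> = (\<Sum>(p, q)\<leftarrow>?E. wedge p q / 2)"
    by (simp add: case_prod_unfold)
  finally show ?thesis .
qed

text \<open>Rules out division by zero in the ratio; one triangle inside \<open>K\<close>
  suffices.\<close>

lemma measure_pos: "measure lebesgue K > 0"
proof -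
  obtain p q where pq: "(p, q) \<in> set (edges (us @ ls))" by (rule edge_exists)
  then have w: "wedge p q > 0" using chain by (auto simp: angular_chain_def)
  obtain H where H: "H \<in> set Hs" "p \<in> region H" "q \<in> region H"
    using fit[OF pq] by (auto simp: fits_def)
  have "0 \<in> region H"
    using H(1) by (rule zero_in_region)
  then have "convex hull {0, p, q} \<subseteq> region H"
    using H by (intro hull_minimal convex_region) auto
  then have "convex hull {0, p, q} \<subseteq> K"
    using H(1) by (auto simp: K_def)
  then have "measure lebesgue (convex hull {0, p, q}) \<le> measure lebesgue K"
    using compact_K triangle_lmeasurable
    by (intro measure_mono_fmeasurable) (auto intro: lmeasurable_compact fmeasurableD)
  then show ?thesis using w by (simp add: measure_triangle_0)
qed

end

section \<open>Squares\<close>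

text \<open>The direction is given by its cosine \<open>a\<close> and sine \<open>b\<close> instead
  of an angle, so that rational directions yield rational half-planes. The vectors are the four
  outward normals.\<close>

definition square_planes :: "real \<Rightarrow> real^2 \<Rightarrow> real \<Rightarrow> real \<Rightarrow> half_planes" where
  "square_planes l c a b =
    [(vector [a, b], vector [a, b] \<bullet> c + l / 2), (vector [- a, - b], vector [- a, - b] \<bullet> c + l / 2),
     (vector [- b, a], vector [- b, a] \<bullet> c + l / 2), (vector [b, - a], vector [b, - a] \<bullet> c + l / 2)]"

lemma inner_real2: "(x :: real^2) \<bullet> y = x $ 1 * y $ 1 + x $ 2 * y $ 2"
  by (simp add: inner_vec_def sum_2)

lemma region_square_planes:
  "region (square_planes l c (cos \<theta>) (sin \<theta>)) = solid_square l c \<theta>"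
proof (rule set_eqI)
  fix z :: "real^2"
  let ?x = "cos \<theta> * (z $ 1 - c $ 1) + sin \<theta> * (z $ 2 - c $ 2)"
  let ?y = "- sin \<theta> * (z $ 1 - c $ 1) + cos \<theta> * (z $ 2 - c $ 2)"
  note cs = sin_cos_squared_add3[of \<theta>]
  have "z \<in> region (square_planes l c (cos \<theta>) (sin \<theta>)) \<longleftrightarrow>
      ?x \<le> l / 2 \<and> - ?x \<le> l / 2 \<and> ?y \<le> l / 2 \<and> - ?y \<le> l / 2"
    by (auto simp: region_def square_planes_def inner_real2 right_diff_distrib)
  also have "\<dots> \<longleftrightarrow> \<bar>?x\<bar> \<le> l / 2 \<and> \<bar>?y\<bar> \<le> l / 2"
    unfolding abs_le_iff by blast
  also have "\<dots> \<longleftrightarrow> z \<in> solid_square l c \<theta>"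
  proof
    assume *: "\<bar>?x\<bar> \<le> l / 2 \<and> \<bar>?y\<bar> \<le> l / 2"
    define x y where "x = ?x" and "y = ?y"
    \<comment> \<open>\<open>?x\<close> and \<open>?y\<close> are the coordinates of
      \<open>z\<close> in the rotated frame at \<open>c\<close>; this rotates them back.\<close>
    have "x * cos \<theta> - y * sin \<theta> = (cos \<theta> * cos \<theta> + sin \<theta> * sin \<theta>) * (z $ 1 - c $ 1)"
      "x * sin \<theta> + y * cos \<theta> = (cos \<theta> * cos \<theta> + sin \<theta> * sin \<theta>) * (z $ 2 - c $ 2)"
      by (simp_all add: x_def y_def algebra_simps del: sin_cos_squared_add3)
    then have "z = c + x *\<^sub>R vector [cos \<theta>, sin \<theta>] + y *\<^sub>R vector [- sin \<theta>, cos \<theta>]"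
      unfolding cs by (simp add: vec_eq_iff forall_2)
    with * show "z \<in> solid_square l c \<theta>"
      unfolding solid_square_def x_def y_def by blast
  next
    assume "z \<in> solid_square l c \<theta>"
    then obtain x y where z: "z = c + x *\<^sub>R vector [cos \<theta>, sin \<theta>] + y *\<^sub>R vector [- sin \<theta>, cos \<theta>]"
      and xy: "\<bar>x\<bar> \<le> l / 2" "\<bar>y\<bar> \<le> l / 2"
      by (auto simp: solid_square_def)
    have zc: "z $ 1 - c $ 1 = x * cos \<theta> - y * sin \<theta>" "z $ 2 - c $ 2 = x * sin \<theta> + y * cos \<theta>"
      by (simp_all add: z)
    have "?x = (cos \<theta> * cos \<theta> + sin \<theta> * sin \<theta>) * x"
      "?y = (cos \<theta> * cos \<theta> + sin \<theta> * sin \<theta>) * y"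
      unfolding zc by (simp_all only: algebra_simps)
    then have "?x = x" "?y = y" by (simp_all only: cs mult_1)
    with xy show "\<bar>?x\<bar> \<le> l / 2 \<and> \<bar>?y\<bar> \<le> l / 2" by simp
  qed
  finally show "z \<in> region (square_planes l c (cos \<theta>) (sin \<theta>)) \<longleftrightarrow> z \<in> solid_square l c \<theta>" .
qed

lemma is_square_region:
  assumes "a\<^sup>2 + b\<^sup>2 = 1"
  shows "is_square l (region (square_planes l c a b))"
  using sincos_total_2pi[OF assms] region_square_planes unfolding is_square_def by metis

lemma bounded_solid_square: "bounded (solid_square l c \<theta>)"
proof (rule boundedI)
  fix z assume "z \<in> solid_square l c \<theta>"
  then obtain x y where z: "z = c + x *\<^sub>R vector [cos \<theta>, sin \<theta>] + y *\<^sub>R vector [- sin \<theta>, cos \<theta>]"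
    and xy: "\<bar>x\<bar> \<le> l / 2" "\<bar>y\<bar> \<le> l / 2"
    by (auto simp: solid_square_def)
  have n: "norm (vector [cos \<theta>, sin \<theta>] :: real^2) = 1" "norm (vector [- sin \<theta>, cos \<theta>] :: real^2) = 1"
    by (simp_all add: norm_eq_sqrt_inner inner_real2 flip: power2_eq_square)
  have "norm z \<le> norm c + \<bar>x\<bar> + \<bar>y\<bar>"
    unfolding z using n by (intro order_trans[OF norm_triangle_ineq] add_mono) simp_all
  then show "norm z \<le> norm c + l" using xy by simp
qed

lemma bounded_is_square: "is_square l Q \<Longrightarrow> bounded Q"
  by (auto simp: is_square_def bounded_solid_square)

section \<open>The five squares\<close>

text \<open>All directions come from the Pythagorean triples (7, 24, 25) and (3, 4, 5), so the vertices of
  the union and its edge lengths are rational.\<close>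

definition squares :: "half_planes list" where
  "squares = [
     square_planes 1 (vector [0, 0]) (1) (0),
     square_planes 1 (vector [0, - 1 / 25]) (24 / 25) (7 / 25),
     square_planes 1 (vector [0, 1 / 25]) (24 / 25) (- 7 / 25),
     square_planes 1 (vector [- 2 / 25, - 1 / 25]) (4 / 5) (3 / 5),
     square_planes 1 (vector [- 2 / 25, 1 / 25]) (4 / 5) (- 3 / 5)]"

text \<open>The boundary runs through all 20 corners of the squares and 22 crossings of their sides.
  The five squares are symmetric under reflection in the horizontal axis, so
  \<open>lower_vertices\<close> mirrors this list in reverse, with its own starting point on the
  negative axis.\<close>

definition upper_vertices :: "(real^2) list" where
  "upper_vertices = [
     vector [103 / 200, 0], vector [31 / 50, 7 / 50], vector [1097 / 1950, 119 / 650],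
     vector [31 / 50, 19 / 50], vector [1 / 2, 83 / 200], vector [1 / 2, 1 / 2],
     vector [109 / 300, 1 / 2], vector [17 / 50, 29 / 50], vector [24 / 175, 25 / 48],
     vector [151 / 1250, 657 / 1250], vector [1 / 50, 33 / 50], vector [- 2 / 75, 5 / 8],
     vector [- 9 / 50, 37 / 50], vector [- 503 / 1950, 3721 / 5850], vector [- 17 / 50, 33 / 50],
     vector [- 29 / 75, 1 / 2], vector [- 1 / 2, 1 / 2], vector [- 1 / 2, 67 / 200],
     vector [- 31 / 50, 3 / 10], vector [- 1153 / 1950, 131 / 650], vector [- 39 / 50, 3 / 50]]"

definition lower_vertices :: "(real^2) list" where
  "lower_vertices = [
     vector [- 147 / 200, 0], vector [- 39 / 50, - 3 / 50], vector [- 1153 / 1950, - 131 / 650],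
     vector [- 31 / 50, - 3 / 10], vector [- 1 / 2, - 67 / 200], vector [- 1 / 2, - 1 / 2],
     vector [- 29 / 75, - 1 / 2], vector [- 17 / 50, - 33 / 50], vector [- 503 / 1950, - 3721 / 5850],
     vector [- 9 / 50, - 37 / 50], vector [- 2 / 75, - 5 / 8], vector [1 / 50, - 33 / 50],
     vector [151 / 1250, - 657 / 1250], vector [24 / 175, - 25 / 48], vector [17 / 50, - 29 / 50],
     vector [109 / 300, - 1 / 2], vector [1 / 2, - 1 / 2], vector [1 / 2, - 83 / 200],
     vector [31 / 50, - 19 / 50], vector [1097 / 1950, - 119 / 650], vector [31 / 50, - 7 / 50]]"

text \<open>Listed in the order of \<open>edges\<close>. The entries are certified as lower bounds
  by comparing squares, which avoids evaluating square roots.\<close>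

definition edge_lengths :: "real list" where
  "edge_lengths = [
     7 / 40, 14 / 195, 8 / 39, 1 / 8, 17 / 200, 41 / 300, 1 / 12,
     71 / 336, 143 / 8400, 21 / 125, 7 / 120, 23 / 120, 76 / 585, 10 / 117,
     1 / 6, 17 / 150, 33 / 200, 1 / 8, 4 / 39, 46 / 195, 3 / 40,
     3 / 40, 46 / 195, 4 / 39, 1 / 8, 33 / 200, 17 / 150, 1 / 6,
     10 / 117, 76 / 585, 23 / 120, 7 / 120, 21 / 125, 143 / 8400, 71 / 336,
     1 / 12, 41 / 300, 17 / 200, 1 / 8, 8 / 39, 14 / 195, 7 / 40]"

lemma wedge_vector: "wedge (vector [a, b]) (vector [c, d]) = a * d - b * c"
  by (simp add: wedge_def)

text \<open>A point of each region that is missing from all later ones tells them apart.\<close>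

lemma distinct_regions:
  assumes "sorted_wrt (\<lambda>(w, H) (w', H'). w \<in> region H \<and> w \<notin> region H') xs"
  shows "distinct (map (region \<circ> snd) xs)"
  using assms by (induction xs) (fastforce+)

lemma dist_geI:
  fixes p q :: "real^2"
  assumes "0 \<le> l" "l\<^sup>2 \<le> (p $ 1 - q $ 1)\<^sup>2 + (p $ 2 - q $ 2)\<^sup>2"
  shows "l \<le> dist p q"
  using assms by (simp add: dist_norm norm_eq_sqrt_inner inner_real2 real_le_rsqrt flip: power2_eq_square)

lemma sum_list_le_map:
  fixes f :: "'a \<Rightarrow> real"
  assumes "list_all2 (\<lambda>x l. l \<le> f x) xs ls"
  shows "sum_list ls \<le> (\<Sum>x\<leftarrow>xs. f x)"
  using assms by (induction rule: list_all2_induct) auto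

lemma edges_vertices:
  "edges (upper_vertices @ lower_vertices) =
    steps (upper_vertices @ lower_vertices @ [hd upper_vertices])"
  by (simp add: edges_def upper_vertices_def)

lemma angular_chain_vertices: "angular_chain upper_vertices lower_vertices"
  unfolding angular_chain_def edges_vertices
  by (simp add: upper_vertices_def lower_vertices_def wedge_vector)

text \<open>A finite check with rational numbers: 42 edges against five squares of four half-planes
  each.\<close>

lemma fits_vertices:
  "\<forall>(p, q)\<in>set (edges (upper_vertices @ lower_vertices)). fits squares p q"
  unfolding edges_vertices
  by (simp add: upper_vertices_def lower_vertices_def fits_def squares_def square_planes_def
      region_def inner_real2)

text \<open>The constant is a convenient rational between the shoelace sum and a quarter of the
  total edge length, which is about 5.454.\<close>

lemma area_vertices: "(\<Sum>(p, q)\<leftarrow>edges (upper_vertices @ lower_vertices). wedge p q / 2) < 1348 / 1000"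
  unfolding edges_vertices
  by (simp add: upper_vertices_def lower_vertices_def wedge_vector)

lemma edge_lengths_vertices:
  "list_all2 (\<lambda>(p, q) l. 0 \<le> l \<and> l\<^sup>2 \<le> (p $ 1 - q $ 1)\<^sup>2 + (p $ 2 - q $ 2)\<^sup>2)
    (edges (upper_vertices @ lower_vertices)) edge_lengths"
  unfolding edges_vertices
  by (simp add: upper_vertices_def lower_vertices_def edge_lengths_def power2_eq_square)

lemma perimeter_vertices: "chain_length (upper_vertices @ lower_vertices) > 4 * (1348 / 1000)"
proof -
  have "list_all2 (\<lambda>e l. l \<le> (case e of (p, q) \<Rightarrow> dist p q))
      (edges (upper_vertices @ lower_vertices)) edge_lengths"
    using edge_lengths_vertices by (rule list_all2_mono) (auto intro: dist_geI)
  then have "sum_list edge_lengths \<le> chain_length (upper_vertices @ lower_vertices)"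
    by (subst chain_length_edges) (auto simp: upper_vertices_def intro!: sum_list_le_map)
  moreover have "sum_list edge_lengths > 4 * (1348 / 1000)"
    by (simp add: edge_lengths_def)
  ultimately show ?thesis by linarith
qed

lemma is_square_squares: "\<forall>H\<in>set squares. is_square 1 (region H)"
  unfolding squares_def
  by (auto intro!: is_square_region simp: power2_eq_square)

lemma star_union_squares: "star_union squares upper_vertices lower_vertices"
proof
  show "0 < h" if "H \<in> set squares" "(n, h) \<in> set H" for H n h
    using that by (auto simp: squares_def square_planes_def inner_real2)
  show "bounded (region H)" if "H \<in> set squares" for H
    using that is_square_squares bounded_is_square by blast
  show "fits squares p q" if "(p, q) \<in> set (edges (upper_vertices @ lower_vertices))" for p q
    using that fits_vertices by blast
qed (rule angular_chain_vertices)

text \<open>Each witness is the corner of one square that lies outside the other four.\<close>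

lemma card_squares: "card (region ` set squares) = 5"
proof -
  let ?ws = "[vector [1 / 2, 1 / 2], vector [17 / 50, 29 / 50], vector [31 / 50, 19 / 50],
    vector [1 / 50, 33 / 50], vector [- 9 / 50, 37 / 50]] :: (real^2) list"
  have "distinct (map (region \<circ> snd) (zip ?ws squares))"
    by (rule distinct_regions)
      (simp add: squares_def square_planes_def region_def inner_real2)
  also have "map (region \<circ> snd) (zip ?ws squares) = map region squares"
    by (simp add: squares_def)
  finally have "card (set (map region squares)) = length squares"
    by (simp only: distinct_card length_map)
  then show ?thesis by (simp add: squares_def)
qed

theorem theorem2p4:
  "\<exists>(P :: (real^2) set) (vs :: (real^2) list) (\<Q> :: (real^2) set set).
     polygon_bounded_by vs P \<and>
     card \<Q> = 5 \<and> (\<forall>Q\<in>\<Q>. is_square 1 Q) \<and> P = \<Union>\<Q> \<and>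
     chain_length vs / measure lebesgue P > 4"
proof -
  interpret star_union squares upper_vertices lower_vertices
    by (rule star_union_squares)
  have "4 * measure lebesgue K < chain_length (upper_vertices @ lower_vertices)"
    using measure_le area_vertices perimeter_vertices by linarith
  then have "chain_length (upper_vertices @ lower_vertices) / measure lebesgue K > 4"
    using measure_pos by (simp add: less_divide_eq)
  moreover have "\<forall>Q\<in>region ` set squares. is_square 1 Q"
    using is_square_squares by blast
  moreover have "K = \<Union>(region ` set squares)"
    by (simp add: K_def)
  ultimately show ?thesis
    using polygon card_squares by blast
qed

end
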